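(* If an $S_3$-like Finsler space $(M,L)$ satisfies the b-condition $b^iC_{ijk}=0$, then its vertical curvature tensor $S_{hijk}$ vanishes.
   Context: $(M,L)$ is an $n$-dimensional smooth Finsler manifold; $\dot\partial_i=\partial/\partial y^i$, $g_{ij}=\frac12\dot\partial_i\dot\partial_jL^2$, $l_i=\dot\partial_iL$, $y_i=g_{ij}y^j$, $h_{ij}=g_{ij}-l_il_j$, $C_{ijk}=\frac12\dot\partial_kg_{ij}$, $C^i_{jk}=g^{ir}C_{rjk}$. The v-curvature (vertical curvature) tensor of the Cartan connection is, up to sign convention, $S_{lijk}=C_{lkr}C^r_{ij}-C_{ljr}C^r_{ik}$; $S$ denotes the vertical scalar curvature, i.e. the full metric contraction of $S_{lijk}$ (trace of the vertical Ricci tensor $S_{ik}$). A 1-form $b_i(x)dx^i$ on $M$ is given, with $\beta=b_iy^i$, $b^i=g^{ij}b_j$, and it is assumed that $m_i:=b_i-(\beta/L^2)y_i\neq0$ and $m^2:=g^{ij}m_im_j\ne0$ at the points under consideration. A Finsler space of dimension $n>3$ is $S_3$-like if $S_{lijk}=\frac{S}{(n-1)(n-2)}\{h_{ik}h_{lj}-h_{ij}h_{lk}\}$ (with the sign convention for $S$ consistent with this identity). *)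

theory Defs
  imports "HOL-Analysis.Analysis"
begin

section \<open>Smooth manifolds\<close>

(* C^k and smooth maps; meant for open S, where the derivative "at x" is the derivative within S. *)
primrec Ck_on :: "nat \<Rightarrow> ('a::real_normed_vector \<Rightarrow> 'b::real_normed_vector) \<Rightarrow> 'a set \<Rightarrow> bool" where
  "Ck_on 0 f S = continuous_on S f"
| "Ck_on (Suc k) f S = ((\<forall>x\<in>S. f differentiable (at x)) \<and>
     (\<forall>v. Ck_on k (\<lambda>x. frechet_derivative f (at x) v) S))"

definition smooth_on :: "('a::real_normed_vector \<Rightarrow> 'b::real_normed_vector) \<Rightarrow> 'a set \<Rightarrow> bool" where
  "smooth_on f S \<longleftrightarrow> (\<forall>k. Ck_on k f S)"

(* A chart is a coordinate domain together with its coordinate map (irrelevant outside the domain). *)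
type_synonym ('m, 'n) chart = "'m set \<times> ('m \<Rightarrow> real ^ 'n)"

abbreviation chart_dom :: "('m, 'n::finite) chart \<Rightarrow> 'm set" where
  "chart_dom c \<equiv> fst c"

abbreviation chart_inv :: "('m, 'n::finite) chart \<Rightarrow> real ^ 'n \<Rightarrow> 'm" where
  "chart_inv c \<equiv> inv_into (fst c) (snd c)"

abbreviation chart_cod :: "('m, 'n::finite) chart \<Rightarrow> (real ^ 'n) set" where
  "chart_cod c \<equiv> snd c ` fst c"

definition transition :: "('m, 'n::finite) chart \<Rightarrow> ('m, 'n) chart \<Rightarrow> real ^ 'n \<Rightarrow> real ^ 'n" where
  "transition c d = snd d \<circ> chart_inv c"

abbreviation overlap :: "('m, 'n::finite) chart \<Rightarrow> ('m, 'n) chart \<Rightarrow> (real ^ 'n) set" where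
  "overlap c d \<equiv> snd c ` (fst c \<inter> fst d)"

(* The manifold M is the whole type 'm; its dimension is n = CARD('n). *)
definition smooth_atlas :: "('m::topological_space, 'n::finite) chart set \<Rightarrow> bool" where
  "smooth_atlas A \<longleftrightarrow>
     (\<Union>c\<in>A. chart_dom c) = UNIV \<and>
     (\<forall>c\<in>A. open (chart_dom c) \<and> open (chart_cod c) \<and>
        homeomorphism (chart_dom c) (chart_cod c) (snd c) (chart_inv c)) \<and>
     (\<forall>c\<in>A. \<forall>d\<in>A. smooth_on (transition c d) (overlap c d))"

(* Change of the induced coordinates (x, y) on the tangent bundle. *)
definition tangent_transition ::
  "('m, 'n::finite) chart \<Rightarrow> ('m, 'n) chart \<Rightarrow> (real ^ 'n) \<times> (real ^ 'n) \<Rightarrow> (real ^ 'n) \<times> (real ^ 'n)" where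
  "tangent_transition c d = (\<lambda>(x, y).
     (transition c d x, frechet_derivative (transition c d) (at x) y))"

section \<open>Tensors of a Finsler function in one chart\<close>

text \<open>
  Below, F x y is the coordinate expression of the Finsler function. The vertical derivative
  with respect to y^i keeps x fixed.
\<close>

definition vderiv :: "'n::finite \<Rightarrow> (real ^ 'n \<Rightarrow> real) \<Rightarrow> real ^ 'n \<Rightarrow> real" where
  "vderiv i f y = frechet_derivative f (at y) (axis i 1)"

context
  fixes F :: "real ^ 'n::finite \<Rightarrow> real ^ 'n \<Rightarrow> real"
begin

definition metric :: "real ^ 'n \<Rightarrow> real ^ 'n \<Rightarrow> real ^ 'n ^ 'n" where
  "metric x y = (\<chi> i j. 1/2 * vderiv i (vderiv j (\<lambda>v. (F x v)\<^sup>2)) y)"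

definition inv_metric :: "real ^ 'n \<Rightarrow> real ^ 'n \<Rightarrow> real ^ 'n ^ 'n" where
  "inv_metric x y = matrix_inv (metric x y)"

definition l_low :: "real ^ 'n \<Rightarrow> real ^ 'n \<Rightarrow> 'n \<Rightarrow> real" where
  "l_low x y i = vderiv i (F x) y"

definition y_low :: "real ^ 'n \<Rightarrow> real ^ 'n \<Rightarrow> 'n \<Rightarrow> real" where
  "y_low x y i = (\<Sum>j\<in>UNIV. metric x y $ i $ j * y $ j)"

definition angular_metric :: "real ^ 'n \<Rightarrow> real ^ 'n \<Rightarrow> 'n \<Rightarrow> 'n \<Rightarrow> real" where
  "angular_metric x y i j = metric x y $ i $ j - l_low x y i * l_low x y j"

definition cartan :: "real ^ 'n \<Rightarrow> real ^ 'n \<Rightarrow> 'n \<Rightarrow> 'n \<Rightarrow> 'n \<Rightarrow> real" where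
  "cartan x y i j k = 1/2 * vderiv k (\<lambda>v. metric x v $ i $ j) y"

(* cartan_up x y i j k is C^i_{jk}. *)
definition cartan_up :: "real ^ 'n \<Rightarrow> real ^ 'n \<Rightarrow> 'n \<Rightarrow> 'n \<Rightarrow> 'n \<Rightarrow> real" where
  "cartan_up x y i j k = (\<Sum>r\<in>UNIV. inv_metric x y $ i $ r * cartan x y r j k)"

definition vcurvature :: "real ^ 'n \<Rightarrow> real ^ 'n \<Rightarrow> 'n \<Rightarrow> 'n \<Rightarrow> 'n \<Rightarrow> 'n \<Rightarrow> real" where
  "vcurvature x y l i j k =
     (\<Sum>r\<in>UNIV. cartan x y l k r * cartan_up x y r i j - cartan x y l j r * cartan_up x y r i k)"

(* S_{ik} = g^{lj} S_{lijk}. Contracting l with j, and not with k, fixes the sign of the scalar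
   curvature so that the S3-like identity below is consistent with its own full trace. *)
definition vricci :: "real ^ 'n \<Rightarrow> real ^ 'n \<Rightarrow> 'n \<Rightarrow> 'n \<Rightarrow> real" where
  "vricci x y i k = (\<Sum>l\<in>UNIV. \<Sum>j\<in>UNIV. inv_metric x y $ l $ j * vcurvature x y l i j k)"

definition vscalar :: "real ^ 'n \<Rightarrow> real ^ 'n \<Rightarrow> real" where
  "vscalar x y = (\<Sum>i\<in>UNIV. \<Sum>k\<in>UNIV. inv_metric x y $ i $ k * vricci x y i k)"

text \<open>In the following, b is the coordinate expression of a 1-form: b x has components b_i(x).\<close>

context
  fixes b :: "real ^ 'n \<Rightarrow> real ^ 'n"
begin

definition beta :: "real ^ 'n \<Rightarrow> real ^ 'n \<Rightarrow> real" where
  "beta x y = (\<Sum>i\<in>UNIV. b x $ i * y $ i)"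

definition b_up :: "real ^ 'n \<Rightarrow> real ^ 'n \<Rightarrow> 'n \<Rightarrow> real" where
  "b_up x y i = (\<Sum>j\<in>UNIV. inv_metric x y $ i $ j * b x $ j)"

definition m_low :: "real ^ 'n \<Rightarrow> real ^ 'n \<Rightarrow> 'n \<Rightarrow> real" where
  "m_low x y i = b x $ i - beta x y / (F x y)\<^sup>2 * y_low x y i"

definition m_sq :: "real ^ 'n \<Rightarrow> real ^ 'n \<Rightarrow> real" where
  "m_sq x y = (\<Sum>i\<in>UNIV. \<Sum>j\<in>UNIV. inv_metric x y $ i $ j * m_low x y i * m_low x y j)"

end

end

section \<open>Finsler manifolds\<close>

text \<open>
  A Finsler function on M is given by its expressions L c in the charts c of the atlas, subject
  to invariance under changes of coordinates. D c is the expression in the chart c of its domain: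
  an open conic subset of the slit tangent bundle that meets every tangent space.
  The case where D c consists of all (x, y) with x in the coordinate range and y \<noteq> 0 is the one of
  a Finsler function on the whole slit tangent bundle. Proper conic domains are included because
  a globally defined positive L with nondegenerate metric and b^i C_{ijk} = 0 is Riemannian
  wherever b does not vanish.
\<close>

definition finsler_manifold ::
  "('m::topological_space, 'n::finite) chart set \<Rightarrow>
   (('m, 'n) chart \<Rightarrow> ((real ^ 'n) \<times> (real ^ 'n)) set) \<Rightarrow>
   (('m, 'n) chart \<Rightarrow> real ^ 'n \<Rightarrow> real ^ 'n \<Rightarrow> real) \<Rightarrow> bool" where
  "finsler_manifold A D L \<longleftrightarrow>
     smooth_atlas A \<and>
     (\<forall>c\<in>A. open (D c) \<and> D c \<subseteq> chart_cod c \<times> (UNIV - {0}) \<and>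
        (\<forall>x\<in>chart_cod c. \<exists>y. (x, y) \<in> D c) \<and>
        smooth_on (\<lambda>(x, y). L c x y) (D c) \<and>
        (\<forall>(x, y)\<in>D c. L c x y > 0 \<and> invertible (metric (L c) x y) \<and>
           (\<forall>t>0. (x, t *\<^sub>R y) \<in> D c \<and> L c x (t *\<^sub>R y) = t * L c x y))) \<and>
     (\<forall>c\<in>A. \<forall>d\<in>A. \<forall>x\<in>overlap c d. \<forall>y.
        ((x, y) \<in> D c \<longleftrightarrow> tangent_transition c d (x, y) \<in> D d) \<and>
        ((x, y) \<in> D c \<longrightarrow> L c x y = case_prod (L d) (tangent_transition c d (x, y))))"

definition one_form ::
  "('m::topological_space, 'n::finite) chart set \<Rightarrow> (('m, 'n) chart \<Rightarrow> real ^ 'n \<Rightarrow> real ^ 'n) \<Rightarrow> bool" where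
  "one_form A b \<longleftrightarrow>
     (\<forall>c\<in>A. smooth_on (b c) (chart_cod c)) \<and>
     (\<forall>c\<in>A. \<forall>d\<in>A. \<forall>x\<in>overlap c d. \<forall>v.
        b c x \<bullet> v = b d (transition c d x) \<bullet> frechet_derivative (transition c d) (at x) v)"

definition S3_like ::
  "('m, 'n::finite) chart set \<Rightarrow> (('m, 'n) chart \<Rightarrow> ((real ^ 'n) \<times> (real ^ 'n)) set) \<Rightarrow>
   (('m, 'n) chart \<Rightarrow> real ^ 'n \<Rightarrow> real ^ 'n \<Rightarrow> real) \<Rightarrow> bool" where
  "S3_like A D L \<longleftrightarrow> CARD('n) > 3 \<and>
     (\<forall>c\<in>A. \<forall>(x, y)\<in>D c. \<forall>l i j k.
        vcurvature (L c) x y l i j k =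
          vscalar (L c) x y / ((real CARD('n) - 1) * (real CARD('n) - 2)) *
          (angular_metric (L c) x y i k * angular_metric (L c) x y l j
           - angular_metric (L c) x y i j * angular_metric (L c) x y l k))"

definition b_condition ::
  "('m, 'n::finite) chart set \<Rightarrow> (('m, 'n) chart \<Rightarrow> ((real ^ 'n) \<times> (real ^ 'n)) set) \<Rightarrow>
   (('m, 'n) chart \<Rightarrow> real ^ 'n \<Rightarrow> real ^ 'n \<Rightarrow> real) \<Rightarrow>
   (('m, 'n) chart \<Rightarrow> real ^ 'n \<Rightarrow> real ^ 'n) \<Rightarrow> bool" where
  "b_condition A D L b \<longleftrightarrow>
     (\<forall>c\<in>A. \<forall>(x, y)\<in>D c. \<forall>j k.
        (\<Sum>i\<in>UNIV. b_up (L c) (b c) x y i * cartan (L c) x y i j k) = 0)"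

end

theory Submission
  imports Defs
begin

text \<open>
  Fix a chart and a point (x, y). Contracting the first index of the vertical curvature
  S_{lijk} = C_{lkr} C^r_{ij} - C_{ljr} C^r_{ik} with b^l gives zero, because both terms then
  contain b^l C_{l..}, which the b-condition kills. The S3-like form of the curvature is
  S_{lijk} = K (h_{ik} h_{lj} - h_{ij} h_{lk}), and b^l h_{lj} = m_j; so the same contraction reads
  K (h_{ik} m_j - h_{ij} m_k) = 0.

  If K were nonzero, contracting with m^j, for which h_{ij} m^j = m_i, would give
  m^2 h_{ik} = m_i m_k: the angular metric would have rank one. But the metric trace of h is
  n - 1, whereas the trace of m_i m_k is m^2, so that m^2 (n - 1) = m^2, which is absurd for
  m^2 \<noteq> 0 and n > 3. Hence K = 0, and the curvature vanishes at (x, y). This linear algebra is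
  the lemma \<open>angular_metric_pinching\<close>.

  The relations b^l h_{lj} = m_j, h_{ij} m^j = m_i and g^{ij} h_{ij} = n - 1 all follow from three
  facts about a Finsler function F, which is positively homogeneous of degree one in y:
  g_{ij} is symmetric, l_i y^i = F, and g_{ij} y^j = F l_i. The last two come from
  Euler's theorem on homogeneous functions, applied to F and to its first derivatives
  (lemmas \<open>l_low_contract\<close> and \<open>y_low_eq\<close>). Symmetry is the theorem of Schwarz on mixed partial
  derivatives (lemma \<open>frechet_derivative_commute\<close>). Since F is smooth as a function of (x, y)
  jointly, while the tensors involve only derivatives in y, smoothness has to be transferred to
  the slices of the domain with x held constant (lemma \<open>smooth_on_slice\<close>).
\<close>

section \<open>Symmetry of second derivatives\<close>

lemma directional_DERIV:
  fixes f :: "'a::real_normed_vector \<Rightarrow> real"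
  assumes "f differentiable (at (p + t *\<^sub>R u))"
  shows "((\<lambda>t. f (p + t *\<^sub>R u)) has_real_derivative
           frechet_derivative f (at (p + t *\<^sub>R u)) u) (at t)"
proof -
  let ?f' = "frechet_derivative f (at (p + t *\<^sub>R u))"
  have f: "(f has_derivative ?f') (at (p + t *\<^sub>R u))"
    using assms frechet_derivative_works by blast
  have "((\<lambda>t. p + t *\<^sub>R u) has_derivative (\<lambda>h. h *\<^sub>R u)) (at t)"
    by (auto intro!: derivative_eq_intros)
  from has_derivative_compose[OF this f]
  have "((\<lambda>t. f (p + t *\<^sub>R u)) has_derivative (\<lambda>h. ?f' (h *\<^sub>R u))) (at t)" .
  moreover have "?f' (h *\<^sub>R u) = ?f' u * h" for h
    using linear_frechet_derivative[OF assms] by (simp add: linear_cmul)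
  ultimately show ?thesis
    by (simp add: has_field_derivative_def)
qed

text \<open>
  The mean value theorem, applied first to a \<mapsto> f (p + s v + a u) - f (p + a u) and then to the
  derivative of f in the direction u along v, turns the second difference of f over a
  parallelogram into a mixed second derivative at one of its points. The second difference is
  symmetric in u and v, which is what makes mixed derivatives commute.
\<close>

lemma mixed_difference_mean_value:
  fixes f :: "'a::real_normed_vector \<Rightarrow> real"
  assumes s: "s > 0"
    and U: "\<And>a b. \<lbrakk>0 \<le> a; a \<le> s; 0 \<le> b; b \<le> s\<rbrakk> \<Longrightarrow> p + a *\<^sub>R u + b *\<^sub>R v \<in> U"
    and f: "\<And>x. x \<in> U \<Longrightarrow> f differentiable (at x)"
    and fu: "\<And>x. x \<in> U \<Longrightarrow> (\<lambda>x. frechet_derivative f (at x) u) differentiable (at x)"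
  obtains a b where "0 \<le> a" "a \<le> s" "0 \<le> b" "b \<le> s"
    "f (p + s *\<^sub>R u + s *\<^sub>R v) - f (p + s *\<^sub>R u) - f (p + s *\<^sub>R v) + f p =
     s * s * frechet_derivative (\<lambda>x. frechet_derivative f (at x) u)
               (at (p + a *\<^sub>R u + b *\<^sub>R v)) v"
proof -
  let ?fu = "\<lambda>x. frechet_derivative f (at x) u"
  let ?\<phi> = "\<lambda>a. f ((p + s *\<^sub>R v) + a *\<^sub>R u) - f (p + a *\<^sub>R u)"
  let ?\<phi>' = "\<lambda>a. ?fu ((p + s *\<^sub>R v) + a *\<^sub>R u) - ?fu (p + a *\<^sub>R u)"
  have "(?\<phi> has_real_derivative ?\<phi>' a) (at a)" if "0 \<le> a" "a \<le> s" for a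
  proof (intro DERIV_diff directional_DERIV f)
    show "p + s *\<^sub>R v + a *\<^sub>R u \<in> U"
      using U[of a s] that s by (simp add: algebra_simps)
    show "p + a *\<^sub>R u \<in> U"
      using U[of a 0] that s by simp
  qed
  from MVT2[OF s this] obtain a where a: "0 < a" "a < s" and \<phi>: "?\<phi> s - ?\<phi> 0 = s * ?\<phi>' a"
    by auto
  let ?\<psi>' = "\<lambda>b. frechet_derivative ?fu (at ((p + a *\<^sub>R u) + b *\<^sub>R v)) v"
  have "((\<lambda>b. ?fu ((p + a *\<^sub>R u) + b *\<^sub>R v)) has_real_derivative ?\<psi>' b) (at b)"
    if "0 \<le> b" "b \<le> s" for b
    by (intro directional_DERIV fu U) (use that a in auto)
  from MVT2[OF s this] obtain b where b: "0 < b" "b < s"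
    and \<psi>: "?fu ((p + a *\<^sub>R u) + s *\<^sub>R v) - ?fu ((p + a *\<^sub>R u) + 0 *\<^sub>R v) = s * ?\<psi>' b"
    by auto
  have "f (p + s *\<^sub>R u + s *\<^sub>R v) - f (p + s *\<^sub>R u) - f (p + s *\<^sub>R v) + f p = s * (s * ?\<psi>' b)"
    using \<phi> \<psi> by (simp add: algebra_simps)
  then show thesis
    using a b that[of a b] by (simp add: mult.assoc)
qed

text \<open>
  Both mixed derivatives equal the second difference divided by s^2 at points of the
  parallelogram spanned by s u and s v at p; as the parallelogram shrinks to p, continuity
  forces the two values at p to agree.
\<close>

lemma frechet_derivative_commute:
  fixes f :: "'a::real_normed_vector \<Rightarrow> real"
  assumes "open U" "p \<in> U"
    and f: "\<And>x. x \<in> U \<Longrightarrow> f differentiable (at x)"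
    and fu: "\<And>x. x \<in> U \<Longrightarrow> (\<lambda>x. frechet_derivative f (at x) u) differentiable (at x)"
    and fv: "\<And>x. x \<in> U \<Longrightarrow> (\<lambda>x. frechet_derivative f (at x) v) differentiable (at x)"
    and fuv: "continuous_on U
      (\<lambda>x. frechet_derivative (\<lambda>x. frechet_derivative f (at x) u) (at x) v)"
    and fvu: "continuous_on U
      (\<lambda>x. frechet_derivative (\<lambda>x. frechet_derivative f (at x) v) (at x) u)"
  shows "frechet_derivative (\<lambda>x. frechet_derivative f (at x) u) (at p) v =
         frechet_derivative (\<lambda>x. frechet_derivative f (at x) v) (at p) u"
proof (rule ccontr)
  let ?P = "\<lambda>x. frechet_derivative (\<lambda>x. frechet_derivative f (at x) u) (at x) v"
  let ?Q = "\<lambda>x. frechet_derivative (\<lambda>x. frechet_derivative f (at x) v) (at x) u"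
  assume "?P p \<noteq> ?Q p"
  define e where "e = \<bar>?P p - ?Q p\<bar> / 2"
  have "e > 0"
    using \<open>?P p \<noteq> ?Q p\<close> by (simp add: e_def)
  have "isCont ?P p" "isCont ?Q p"
    using fuv fvu assms(1,2) continuous_on_eq_continuous_at by blast+
  then have "\<exists>d>0. \<forall>x. dist x p < d \<longrightarrow> dist (?P x) (?P p) < e"
    and "\<exists>d>0. \<forall>x. dist x p < d \<longrightarrow> dist (?Q x) (?Q p) < e"
    using \<open>e > 0\<close> by (simp_all add: continuous_at_eps_delta)
  then obtain d1 d2 where d: "d1 > 0" "d2 > 0"
    "\<And>x. dist x p < d1 \<Longrightarrow> dist (?P x) (?P p) < e"
    "\<And>x. dist x p < d2 \<Longrightarrow> dist (?Q x) (?Q p) < e"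
    by blast
  obtain d3 where d3: "d3 > 0" "ball p d3 \<subseteq> U"
    using assms(1,2) open_contains_ball by blast
  define r where "r = min d1 (min d2 d3)"
  \<comment> \<open>Scaling by the lengths of u and v keeps the whole parallelogram inside the ball of radius r;
     the summand 1 covers the case u = v = 0.\<close>
  define s where "s = r / (norm u + norm v + 1)"
  have N: "norm u + norm v + 1 > 0"
    by (smt (verit) norm_ge_zero)
  have "r > 0" "s > 0"
    using d d3 N by (auto simp: r_def s_def)
  have near: "dist (p + a *\<^sub>R u + b *\<^sub>R v) p < r"
    if "0 \<le> a" "a \<le> s" "0 \<le> b" "b \<le> s" for a b
  proof -
    have "dist (p + a *\<^sub>R u + b *\<^sub>R v) p = norm (a *\<^sub>R u + b *\<^sub>R v)"
      by (simp add: dist_norm algebra_simps)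
    also have "\<dots> \<le> a * norm u + b * norm v"
      using that norm_triangle_ineq[of "a *\<^sub>R u" "b *\<^sub>R v"] by simp
    also have "\<dots> \<le> s * norm u + s * norm v"
      using that by (intro add_mono mult_right_mono) auto
    also have "\<dots> < s * (norm u + norm v + 1)"
      using \<open>s > 0\<close> by (simp add: algebra_simps)
    also have "\<dots> = r"
      using N by (simp add: s_def)
    finally show ?thesis .
  qed
  have inU: "p + a *\<^sub>R u + b *\<^sub>R v \<in> U" if "0 \<le> a" "a \<le> s" "0 \<le> b" "b \<le> s" for a b
    using near[OF that] d3 by (auto simp: r_def dist_commute)
  have inU': "p + a *\<^sub>R v + b *\<^sub>R u \<in> U" if "0 \<le> a" "a \<le> s" "0 \<le> b" "b \<le> s" for a b
    using inU[of b a] that by (simp add: algebra_simps)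
  obtain a b where ab: "0 \<le> a" "a \<le> s" "0 \<le> b" "b \<le> s" and
    1: "f (p + s *\<^sub>R u + s *\<^sub>R v) - f (p + s *\<^sub>R u) - f (p + s *\<^sub>R v) + f p =
        s * s * ?P (p + a *\<^sub>R u + b *\<^sub>R v)"
    using mixed_difference_mean_value[OF \<open>s > 0\<close> inU f fu] by blast
  obtain a' b' where ab': "0 \<le> a'" "a' \<le> s" "0 \<le> b'" "b' \<le> s" and
    2: "f (p + s *\<^sub>R v + s *\<^sub>R u) - f (p + s *\<^sub>R v) - f (p + s *\<^sub>R u) + f p =
        s * s * ?Q (p + a' *\<^sub>R v + b' *\<^sub>R u)"
    using mixed_difference_mean_value[OF \<open>s > 0\<close> inU' f fv] by blast
  have "p + s *\<^sub>R v + s *\<^sub>R u = p + s *\<^sub>R u + s *\<^sub>R v" "p + a' *\<^sub>R v + b' *\<^sub>R u = p + b' *\<^sub>R u + a' *\<^sub>R v"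
    by (simp_all add: algebra_simps)
  with 1 2 have "s * s * ?P (p + a *\<^sub>R u + b *\<^sub>R v) = s * s * ?Q (p + b' *\<^sub>R u + a' *\<^sub>R v)"
    by (simp only: diff_diff_eq add.commute)
  then have "?P (p + a *\<^sub>R u + b *\<^sub>R v) = ?Q (p + b' *\<^sub>R u + a' *\<^sub>R v)"
    using \<open>s > 0\<close> by simp
  moreover have "dist (?P (p + a *\<^sub>R u + b *\<^sub>R v)) (?P p) < e"
    using near[OF ab] d by (auto simp: r_def)
  moreover have "dist (?Q (p + b' *\<^sub>R u + a' *\<^sub>R v)) (?Q p) < e"
    using near[OF ab'(3,4) ab'(1,2)] d by (auto simp: r_def)
  ultimately have "\<bar>?P p - ?Q p\<bar> < 2 * e"
    by (simp add: dist_real_def abs_if split: if_splits)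
  then show False
    by (simp add: e_def)
qed

section \<open>Smooth functions and their slices\<close>

lemma smooth_on_differentiable: "smooth_on f S \<Longrightarrow> x \<in> S \<Longrightarrow> f differentiable (at x)"
  by (metis Ck_on.simps(2) smooth_on_def)

lemma smooth_on_frechet_derivative:
  "smooth_on f S \<Longrightarrow> smooth_on (\<lambda>x. frechet_derivative f (at x) v) S"
  unfolding smooth_on_def by (metis Ck_on.simps(2))

lemma smooth_on_continuous: "smooth_on f S \<Longrightarrow> continuous_on S f"
  by (metis Ck_on.simps(1) smooth_on_def)

lemma smooth_on_frechet_derivative_commute:
  fixes f :: "'a::real_normed_vector \<Rightarrow> real"
  assumes "smooth_on f U" "open U" "p \<in> U"
  shows "frechet_derivative (\<lambda>x. frechet_derivative f (at x) u) (at p) v =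
         frechet_derivative (\<lambda>x. frechet_derivative f (at x) v) (at p) u"
  using assms
  by (intro frechet_derivative_commute[of U])
     (auto intro: smooth_on_differentiable smooth_on_frechet_derivative smooth_on_continuous)

text \<open>
  Openness matters: the derivatives in the definition of \<open>Ck_on\<close> are taken in the whole space,
  so they depend on f in a neighbourhood of each point of S.
\<close>

lemma Ck_on_cong:
  assumes "open S" "\<And>x. x \<in> S \<Longrightarrow> f x = g x" "Ck_on k f S"
  shows "Ck_on k g S"
  using assms(2,3)
proof (induction k arbitrary: f g)
  case 0
  then show ?case
    using continuous_on_cong[of S S f g] by simp
next
  case (Suc k)
  have diff: "f differentiable (at x)" if "x \<in> S" for x
    using Suc.prems that by simp
  have "g differentiable (at x)" if "x \<in> S" for x
    using diff[OF that] that \<open>open S\<close> Suc.prems(1)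
    unfolding differentiable_def by (metis has_derivative_transform_within_open)
  moreover have "Ck_on k (\<lambda>x. frechet_derivative g (at x) v) S" for v
  proof (rule Suc.IH)
    show "Ck_on k (\<lambda>x. frechet_derivative f (at x) v) S"
      using Suc.prems by simp
    show "frechet_derivative f (at x) v = frechet_derivative g (at x) v" if "x \<in> S" for x
      using frechet_derivative_transform_within_open[OF diff[OF that] \<open>open S\<close> that Suc.prems(1)]
      by simp
  qed
  ultimately show ?case
    by simp
qed

lemma open_slice:
  assumes "open D" shows "open {v. (x, v) \<in> D}"
proof -
  have "open ((\<lambda>v. (x, v)) -` D)"
    by (intro open_vimage assms continuous_intros)
  then show ?thesis
    by (simp add: vimage_def)
qed

lemma slice_has_derivative:
  assumes "f differentiable (at (x, y))"
  shows "((\<lambda>v. f (x, v)) has_derivative (\<lambda>w. frechet_derivative f (at (x, y)) (0, w))) (at y)"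
proof -
  have "((\<lambda>v. (x, v)) has_derivative (\<lambda>w. (0, w))) (at y)"
    by (auto intro!: derivative_eq_intros)
  from has_derivative_compose[OF this] assms show ?thesis
    by (simp add: frechet_derivative_works)
qed

text \<open>
  The derivative of a slice is the slice of the derivative in a direction (0, w) only at points
  of the domain, so the induction has to exchange the two by \<open>Ck_on_cong\<close>.
\<close>

lemma Ck_on_slice:
  assumes "open D" "Ck_on k f D"
  shows "Ck_on k (\<lambda>v. f (x, v)) {v. (x, v) \<in> D}"
  using assms(2)
proof (induction k arbitrary: f)
  case 0
  then have "continuous_on D f"
    by simp
  then have "continuous_on {v. (x, v) \<in> D} (\<lambda>v. f (x, v))"
    by (rule continuous_on_compose2) (auto intro!: continuous_intros)
  then show ?case
    by simp
next
  case (Suc k)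
  have slice: "((\<lambda>v. f (x, v)) has_derivative (\<lambda>w. frechet_derivative f (at (x, y)) (0, w))) (at y)"
    if "(x, y) \<in> D" for y
    using Suc.prems that by (intro slice_has_derivative) auto
  have "Ck_on k (\<lambda>y. frechet_derivative (\<lambda>v. f (x, v)) (at y) w) {v. (x, v) \<in> D}" for w
  proof (rule Ck_on_cong[OF open_slice[OF assms(1)]])
    show "Ck_on k (\<lambda>y. frechet_derivative f (at (x, y)) (0, w)) {v. (x, v) \<in> D}"
      using Suc.prems by (intro Suc.IH) simp
    show "frechet_derivative f (at (x, y)) (0, w) = frechet_derivative (\<lambda>v. f (x, v)) (at y) w"
      if "y \<in> {v. (x, v) \<in> D}" for y
      using frechet_derivative_at[OF slice, of y] that by (metis mem_Collect_eq)
  qed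
  then show ?case
    using slice by (auto simp: differentiable_def)
qed

lemma smooth_on_slice:
  "open D \<Longrightarrow> smooth_on f D \<Longrightarrow> smooth_on (\<lambda>v. f (x, v)) {v. (x, v) \<in> D}"
  by (simp add: smooth_on_def Ck_on_slice)

section \<open>Homogeneous functions\<close>

lemma sum_vderiv:
  assumes "f differentiable (at y)"
  shows "(\<Sum>i\<in>UNIV. vderiv i f y * w $ i) = frechet_derivative f (at y) w"
proof -
  have lin: "linear (frechet_derivative f (at y))"
    by (rule linear_frechet_derivative[OF assms])
  have "frechet_derivative f (at y) w =
        frechet_derivative f (at y) (\<Sum>i\<in>UNIV. w $ i *\<^sub>R axis i 1)"
    using basis_expansion[of w] by (simp add: scalar_mult_eq_scaleR)
  also have "\<dots> = (\<Sum>i\<in>UNIV. w $ i * frechet_derivative f (at y) (axis i 1))"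
    by (simp add: linear_sum[OF lin] linear_cmul[OF lin])
  finally show ?thesis
    by (simp add: vderiv_def mult.commute)
qed

text \<open>Both sides are the derivative at t = 1 of t \<mapsto> f (t y) = t^k f y.\<close>

lemma Euler_homogeneous:
  assumes "f differentiable (at y)" "\<And>t. t > 0 \<Longrightarrow> f (t *\<^sub>R y) = t ^ k * f y"
  shows "(\<Sum>i\<in>UNIV. vderiv i f y * y $ i) = real k * f y"
proof -
  have "((\<lambda>t. f (0 + t *\<^sub>R y)) has_real_derivative frechet_derivative f (at (0 + 1 *\<^sub>R y)) y) (at 1)"
    by (rule directional_DERIV) (use assms in simp)
  then have "((\<lambda>t. f (t *\<^sub>R y)) has_real_derivative frechet_derivative f (at y) y) (at 1)"
    by simp
  then have "((\<lambda>t. t ^ k * f y) has_real_derivative frechet_derivative f (at y) y) (at 1)"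
    by (rule has_field_derivative_transform_within_open[where S = "{0<..}"]) (use assms in auto)
  moreover have "((\<lambda>t. t ^ k * f y) has_real_derivative real k * f y) (at 1)"
    by (auto intro!: derivative_eq_intros)
  ultimately show ?thesis
    using DERIV_unique sum_vderiv[OF assms(1)] by metis
qed

text \<open>
  Differentiating f (t v) = t f v in v produces a factor t on both sides, so the first
  derivatives of a function of degree one have degree zero.
\<close>

lemma vderiv_homogeneous:
  assumes "open W" "y \<in> W" "t > 0"
    and cone: "\<And>v. v \<in> W \<Longrightarrow> t *\<^sub>R v \<in> W \<and> f (t *\<^sub>R v) = t * f v"
    and diff: "\<And>v. v \<in> W \<Longrightarrow> f differentiable (at v)"
  shows "vderiv j f (t *\<^sub>R y) = vderiv j f y"
proof -
  let ?f' = "\<lambda>y. frechet_derivative f (at y)"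
  have f: "(f has_derivative ?f' v) (at v)" if "v \<in> W" for v
    using diff[OF that] frechet_derivative_works by blast
  have "((\<lambda>v. t *\<^sub>R v) has_derivative (\<lambda>w. t *\<^sub>R w)) (at y)"
    by (auto intro!: derivative_eq_intros)
  from has_derivative_compose[OF this f] cone[OF \<open>y \<in> W\<close>]
  have "((\<lambda>v. f (t *\<^sub>R v)) has_derivative (\<lambda>w. ?f' (t *\<^sub>R y) (t *\<^sub>R w))) (at y)"
    by simp
  then have "((\<lambda>v. t * f v) has_derivative (\<lambda>w. ?f' (t *\<^sub>R y) (t *\<^sub>R w))) (at y)"
    using assms(1,2) cone by (elim has_derivative_transform_within_open) auto
  moreover have "((\<lambda>v. t * f v) has_derivative (\<lambda>w. t * ?f' y w)) (at y)"
    by (intro has_derivative_mult_right f assms)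
  ultimately have "?f' (t *\<^sub>R y) (t *\<^sub>R w) = t * ?f' y w" for w
    using has_derivative_unique by metis
  moreover have "?f' (t *\<^sub>R y) (t *\<^sub>R w) = t * ?f' (t *\<^sub>R y) w" for w
    using linear_cmul[OF linear_frechet_derivative, of f "at (t *\<^sub>R y)"] diff cone \<open>y \<in> W\<close> by simp
  ultimately show ?thesis
    using \<open>t > 0\<close> by (simp add: vderiv_def)
qed

section \<open>The metric of a Finsler function\<close>

text \<open>
  Equivalently, the angular metric is h_{ij} = F \<partial>_i \<partial>_j F. Splitting off the product of
  first derivatives reduces statements about g, defined through F^2, to the Hessian of F.
\<close>

lemma metric_eq_hessian:
  assumes "smooth_on (F x) W" "open W" "y \<in> W"
  shows "metric F x y $ i $ j = l_low F x y i * l_low F x y j + F x y * vderiv i (vderiv j (F x)) y"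
proof -
  let ?f = "F x"
  have diff: "(?f has_derivative frechet_derivative ?f (at v)) (at v)" if "v \<in> W" for v
    using smooth_on_differentiable[OF assms(1) that] frechet_derivative_works by blast
  have "smooth_on (vderiv j ?f) W"
    using smooth_on_frechet_derivative[OF assms(1)] by (simp add: vderiv_def[abs_def])
  then have diffj: "(vderiv j ?f has_derivative frechet_derivative (vderiv j ?f) (at y)) (at y)"
    using smooth_on_differentiable assms(3) frechet_derivative_works by blast
  have "((\<lambda>v. (?f v)\<^sup>2) has_derivative (\<lambda>w. 2 * ?f v * frechet_derivative ?f (at v) w)) (at v)"
    if "v \<in> W" for v
    by (rule derivative_eq_intros diff that refl)+ (auto simp: fun_eq_iff)
  from frechet_derivative_at[OF this]
  have first: "vderiv j (\<lambda>v. (?f v)\<^sup>2) v = 2 * ?f v * vderiv j ?f v" if "v \<in> W" for v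
    using that by (simp add: vderiv_def fun_eq_iff)
  have "((\<lambda>v. 2 * ?f v * vderiv j ?f v) has_derivative
         (\<lambda>w. 2 * (frechet_derivative ?f (at y) w * vderiv j ?f y
            + ?f y * frechet_derivative (vderiv j ?f) (at y) w))) (at y)"
    by (rule derivative_eq_intros diff diffj assms refl)+ (auto simp: fun_eq_iff algebra_simps)
  then have "(vderiv j (\<lambda>v. (?f v)\<^sup>2) has_derivative
         (\<lambda>w. 2 * (frechet_derivative ?f (at y) w * vderiv j ?f y
            + ?f y * frechet_derivative (vderiv j ?f) (at y) w))) (at y)"
    by (rule has_derivative_transform_within_open[OF _ assms(2,3)]) (simp add: first)
  from frechet_derivative_at[OF this, symmetric] show ?thesis
    by (simp add: metric_def vderiv_def l_low_def)
qed

lemma metric_symmetric: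
  assumes "smooth_on (F x) W" "open W" "y \<in> W"
  shows "metric F x y $ i $ j = metric F x y $ j $ i"
proof -
  have "vderiv i (vderiv j (F x)) y = vderiv j (vderiv i (F x)) y"
    using smooth_on_frechet_derivative_commute[OF assms] by (simp add: vderiv_def[abs_def])
  then show ?thesis
    by (simp add: metric_eq_hessian[of F x W y, OF assms] mult.commute)
qed

lemma l_low_contract:
  assumes "F x differentiable (at y)" "\<And>t. t > 0 \<Longrightarrow> F x (t *\<^sub>R y) = t * F x y"
  shows "(\<Sum>i\<in>UNIV. l_low F x y i * y $ i) = F x y"
  using Euler_homogeneous[of "F x" y 1] assms by (simp add: l_low_def)

text \<open>
  Here l_j y^j = F while y^j \<partial>_j l_i = 0, since l_i is homogeneous of degree zero; only the
  product l_i l_j in the metric contributes. The cone W is needed because l_i must be known along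
  the whole ray through y.
\<close>

lemma y_low_eq:
  assumes F: "smooth_on (F x) W" "open W" "y \<in> W"
    and cone: "\<And>t v. t > 0 \<Longrightarrow> v \<in> W \<Longrightarrow> t *\<^sub>R v \<in> W \<and> F x (t *\<^sub>R v) = t * F x v"
  shows "y_low F x y i = F x y * l_low F x y i"
proof -
  have "smooth_on (vderiv i (F x)) W"
    using smooth_on_frechet_derivative[OF F(1)] by (simp add: vderiv_def[abs_def])
  then have "(\<Sum>j\<in>UNIV. vderiv j (vderiv i (F x)) y * y $ j) = real 0 * vderiv i (F x) y"
    using F cone
    by (intro Euler_homogeneous)
       (auto intro: smooth_on_differentiable vderiv_homogeneous[of W])
  then have hess: "(\<Sum>j\<in>UNIV. vderiv j (vderiv i (F x)) y * y $ j) = 0"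
    by simp
  have l: "(\<Sum>j\<in>UNIV. l_low F x y j * y $ j) = F x y"
    using F cone by (intro l_low_contract) (auto intro: smooth_on_differentiable)
  have "y_low F x y i = (\<Sum>j\<in>UNIV. metric F x y $ j $ i * y $ j)"
    using metric_symmetric[of F x W y, OF F] by (simp add: y_low_def)
  also have "\<dots> = (\<Sum>j\<in>UNIV. l_low F x y j * y $ j) * l_low F x y i
      + F x y * (\<Sum>j\<in>UNIV. vderiv j (vderiv i (F x)) y * y $ j)"
    by (simp add: metric_eq_hessian[of F x W y, OF F] distrib_right distrib_left sum.distrib
        sum_distrib_left sum_distrib_right mult_ac)
  finally show ?thesis
    by (simp add: l hess)
qed

section \<open>Vanishing of the vertical curvature\<close>

lemma contract_vcurvature:
  assumes "\<And>j k. (\<Sum>i\<in>UNIV. v i * cartan F x y i j k) = 0"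
  shows "(\<Sum>l\<in>UNIV. v l * vcurvature F x y l i j k) = 0"
proof -
  have "(\<Sum>l\<in>UNIV. v l * (\<Sum>r\<in>UNIV. cartan F x y l p r * w r)) = 0" for p w
  proof -
    have "(\<Sum>l\<in>UNIV. v l * (\<Sum>r\<in>UNIV. cartan F x y l p r * w r)) =
          (\<Sum>r\<in>UNIV. (\<Sum>l\<in>UNIV. v l * cartan F x y l p r) * w r)"
      by (simp add: sum_distrib_left sum_distrib_right mult.assoc) (rule sum.swap)
    then show ?thesis
      by (simp add: assms)
  qed
  then show ?thesis
    by (simp add: vcurvature_def sum_subtractf right_diff_distrib)
qed

text \<open>
  The pointwise linear algebra, with g the metric, l the covector l_i and f the value of F, so
  that the second term of m is (\<beta>/F^2) y_i. The sum over r is the contraction of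
  K (h_{ik} h_{rj} - h_{ij} h_{rk}) with b^r. It equals K (h_{ik} m_j - h_{ij} m_k), and no
  nonzero K is compatible with this being zero: otherwise h would be m_i m_k / m^2, of trace 1
  instead of n - 1. Since g may be indefinite, m \<noteq> 0
  would not ensure m^2 \<noteq> 0.
\<close>

lemma angular_metric_pinching:
  fixes g :: "real ^ 'n ^ 'n" and b y l m :: "real ^ 'n"
  assumes inv: "invertible g" and sym: "transpose g = g"
    and gy: "g *v y = f *\<^sub>R l" and ly: "l \<bullet> y = f" and "f \<noteq> 0"
    and m: "m = b - (b \<bullet> y / f) *\<^sub>R l"
    and h: "\<And>i j. h i j = g $ i $ j - l $ i * l $ j"
    and K: "\<And>i j k. K * (\<Sum>r\<in>UNIV. (matrix_inv g *v b) $ r * (h i k * h r j - h i j * h r k)) = 0"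
    and m2: "m \<bullet> (matrix_inv g *v m) \<noteq> 0" and n: "CARD('n) \<noteq> 2"
  shows "K = 0"
proof (rule ccontr)
  assume "K \<noteq> 0"
  define G where "G = matrix_inv g"
  have "g ** G = mat 1 \<and> G ** g = mat 1"
    using someI_ex[OF inv[unfolded invertible_def]] by (simp add: G_def matrix_inv_def)
  then have Gg: "G ** g = mat 1" and gG: "g ** G = mat 1"
    by simp_all
  have gij: "g $ i $ j = g $ j $ i" for i j
    using sym by (metis transpose_def vec_lambda_beta)
  have "transpose G ** g = transpose (g ** G)"
    by (simp add: matrix_transpose_mul sym)
  also have "\<dots> = mat 1"
    by (simp add: gG transpose_mat)
  finally have "transpose G = G"
    using gG by (metis matrix_mul_assoc matrix_mul_lid matrix_mul_rid)
  then have Gswap: "(G *v v) \<bullet> w = v \<bullet> (G *v w)" for v w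
    by (metis dot_lmul_matrix transpose_matrix_vector)
  have Gij: "G $ i $ j = G $ j $ i" for i j
    using \<open>transpose G = G\<close> by (metis transpose_def vec_lambda_beta)
  \<comment> \<open>Raising the index of l gives y / F.\<close>
  have "f *\<^sub>R (G *v l) = G *v (g *v y)"
    by (simp add: gy matrix_vector_mult_scaleR)
  also have "\<dots> = y"
    by (simp add: matrix_vector_mul_assoc Gg)
  finally have Gl: "G *v l = (1 / f) *\<^sub>R y"
    using \<open>f \<noteq> 0\<close> by (metis divide_self_if eq_vector_fraction_iff scaleR_one)
  have ggG: "g *v (G *v v) = v" for v
    by (simp add: matrix_vector_mul_assoc gG)
  have contract: "(\<Sum>r\<in>UNIV. w $ r * h r j) = (g *v w) $ j - (l \<bullet> w) * l $ j" for w j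
    by (simp add: h matrix_vector_mult_def inner_vec_def right_diff_distrib sum_subtractf
        sum_distrib_right sum_distrib_left gij[of j] mult.commute mult.left_commute)
  have hsym: "h i j = h j i" for i j
    using gij[of i j] by (simp add: h)
  have lGb: "l \<bullet> (G *v b) = b \<bullet> y / f"
    using Gswap[of l b] Gl by (simp add: inner_commute)
  have hb: "(\<Sum>r\<in>UNIV. (G *v b) $ r * h r j) = m $ j" for j
    by (simp add: contract ggG lGb m)
  have "m \<bullet> y = 0"
    using \<open>f \<noteq> 0\<close> by (simp add: m inner_diff_left ly)
  then have lGm: "l \<bullet> (G *v m) = 0"
    using Gswap[of l m] Gl by (simp add: inner_commute)
  have hm: "(\<Sum>r\<in>UNIV. (G *v m) $ r * h r j) = m $ j" for j
    by (simp add: contract ggG lGm)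
  have "h i k * m $ j = h i j * m $ k" for i j k
  proof -
    have "(\<Sum>r\<in>UNIV. (G *v b) $ r * (h i k * h r j - h i j * h r k)) =
          h i k * (\<Sum>r\<in>UNIV. (G *v b) $ r * h r j) - h i j * (\<Sum>r\<in>UNIV. (G *v b) $ r * h r k)"
      by (simp add: algebra_simps sum_subtractf sum_distrib_left)
    then show ?thesis
      using K[of i k j] \<open>K \<noteq> 0\<close> hb by (simp add: G_def)
  qed
  then have "(\<Sum>j\<in>UNIV. (G *v m) $ j * (h i k * m $ j)) =
             (\<Sum>j\<in>UNIV. (G *v m) $ j * (h j i * m $ k))" for i k
    by (simp add: hsym)
  moreover have "(\<Sum>j\<in>UNIV. (G *v m) $ j * (h i k * m $ j)) = (m \<bullet> (G *v m)) * h i k" for i k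
    by (simp add: inner_vec_def sum_distrib_left sum_distrib_right algebra_simps)
  moreover have "(\<Sum>j\<in>UNIV. (G *v m) $ j * (h j i * m $ k)) = m $ i * m $ k" for i k
    using hm[of i] by (simp flip: mult.assoc sum_distrib_right)
  \<comment> \<open>So h would have rank one; comparing metric traces contradicts this.\<close>
  ultimately have rank1: "(m \<bullet> (G *v m)) * h i k = m $ i * m $ k" for i k
    by simp
  have quad: "(\<Sum>i\<in>UNIV. \<Sum>k\<in>UNIV. G $ i $ k * (v $ i * v $ k)) = v \<bullet> (G *v v)" for v
    by (simp add: inner_vec_def matrix_vector_mult_def sum_distrib_left algebra_simps)
  have "(\<Sum>i\<in>UNIV. \<Sum>k\<in>UNIV. G $ i $ k * g $ i $ k) = (\<Sum>i\<in>UNIV. (G ** g) $ i $ i)"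
    by (simp add: matrix_matrix_mult_def gij)
  also have "\<dots> = real CARD('n)"
    by (simp add: Gg mat_def)
  finally have "(\<Sum>i\<in>UNIV. \<Sum>k\<in>UNIV. G $ i $ k * h i k) = real CARD('n) - l \<bullet> (G *v l)"
    by (simp add: h right_diff_distrib sum_subtractf quad)
  also have "\<dots> = real CARD('n) - 1"
    using ly \<open>f \<noteq> 0\<close> by (simp add: Gl)
  finally have "(m \<bullet> (G *v m)) * (real CARD('n) - 1) =
        (m \<bullet> (G *v m)) * (\<Sum>i\<in>UNIV. \<Sum>k\<in>UNIV. G $ i $ k * h i k)"
    by simp
  also have "\<dots> = (\<Sum>i\<in>UNIV. \<Sum>k\<in>UNIV. G $ i $ k * ((m \<bullet> (G *v m)) * h i k))"
    unfolding sum_distrib_left by (intro sum.cong refl) (simp only: mult.left_commute)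
  also have "\<dots> = m \<bullet> (G *v m)"
    by (simp add: rank1 quad)
  finally show False
    using m2 n by (simp add: G_def)
qed


theorem theorem4p5:
  fixes A :: "('m::{t2_space, second_countable_topology}, 'n::finite) chart set"
    and D :: "('m, 'n) chart \<Rightarrow> ((real ^ 'n) \<times> (real ^ 'n)) set"
    and L :: "('m, 'n) chart \<Rightarrow> real ^ 'n \<Rightarrow> real ^ 'n \<Rightarrow> real"
    and b :: "('m, 'n) chart \<Rightarrow> real ^ 'n \<Rightarrow> real ^ 'n"
  assumes "finsler_manifold A D L"
    and "one_form A b"
    and "S3_like A D L"
    and "b_condition A D L b"
  shows "\<forall>c\<in>A. \<forall>(x, y)\<in>D c.
           (\<exists>i. m_low (L c) (b c) x y i \<noteq> 0) \<and> m_sq (L c) (b c) x y \<noteq> 0 \<longrightarrow>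
           (\<forall>h i j k. vcurvature (L c) x y h i j k = 0)"
proof (intro ballI, clarify)
  fix c x y h i j k
  assume c: "c \<in> A" and xy: "(x, y) \<in> D c" and m_sq: "m_sq (L c) (b c) x y \<noteq> 0"
  let ?F = "L c" and ?W = "{v. (x, v) \<in> D c}"
  let ?g = "metric ?F x y" and ?f = "?F x y" and ?b = "b c x"
  let ?h = "angular_metric ?F x y" and ?S = "vcurvature ?F x y"
  define l :: "real ^ 'n" where "l = (\<chi> i. l_low ?F x y i)"
  define m :: "real ^ 'n" where "m = (\<chi> i. m_low ?F (b c) x y i)"
  define K where "K = vscalar ?F x y / ((real CARD('n) - 1) * (real CARD('n) - 2))"
  have D: "open (D c)" "smooth_on (\<lambda>(x, y). ?F x y) (D c)"
    using assms(1) c unfolding finsler_manifold_def by blast+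
  have pos: "?f > 0" and inv: "invertible ?g"
    using assms(1) c xy unfolding finsler_manifold_def by blast+
  have cone: "t *\<^sub>R v \<in> ?W \<and> ?F x (t *\<^sub>R v) = t * ?F x v" if "t > 0" "v \<in> ?W" for t v
    using assms(1) c that unfolding finsler_manifold_def by blast
  have W: "smooth_on (?F x) ?W" "open ?W" "y \<in> ?W"
    using smooth_on_slice[OF D, of x] open_slice[OF D(1), of x] xy by simp_all
  have n: "CARD('n) > 3"
    and S: "?S l i j k = K * (?h i k * ?h l j - ?h i j * ?h l k)" for l i j k
    using assms(3) c xy unfolding S3_like_def K_def by blast+
  have bC: "(\<Sum>i\<in>UNIV. b_up ?F (b c) x y i * cartan ?F x y i j k) = 0" for j k
    using assms(4) c xy unfolding b_condition_def by blast
  have y_low: "y_low ?F x y i = ?f * l $ i" for i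
    using y_low_eq[of ?F x ?W y i, OF W cone] by (simp add: l_def)
  have b_up: "b_up ?F (b c) x y = (\<lambda>i. (matrix_inv ?g *v ?b) $ i)"
    by (simp add: b_up_def inv_metric_def matrix_vector_mult_def fun_eq_iff)
  have "K = 0"
  proof (rule angular_metric_pinching[OF inv])
    show "transpose ?g = ?g"
      using metric_symmetric[of ?F x ?W y, OF W] by (simp add: transpose_def vec_eq_iff)
    show "?g *v y = ?f *\<^sub>R l"
      using y_low by (simp add: y_low_def vec_eq_iff matrix_vector_mult_def)
    show "l \<bullet> y = ?f"
      using l_low_contract[of ?F x y] smooth_on_differentiable[OF W(1,3)] cone W(3)
      by (simp add: l_def inner_vec_def)
    show "m = ?b - (?b \<bullet> y / ?f) *\<^sub>R l"
      using pos by (simp add: m_def m_low_def beta_def y_low inner_vec_def vec_eq_iff power2_eq_square)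
    show "?h i j = ?g $ i $ j - l $ i * l $ j" for i j
      by (simp add: angular_metric_def l_def)
    show "K * (\<Sum>r\<in>UNIV. (matrix_inv ?g *v ?b) $ r * (?h i k * ?h r j - ?h i j * ?h r k)) = 0"
      for i j k
      using contract_vcurvature[of "b_up ?F (b c) x y", OF bC, of i j k]
      by (simp add: S b_up sum_distrib_left mult.left_commute)
    show "m \<bullet> (matrix_inv ?g *v m) \<noteq> 0"
      using m_sq
      by (simp add: m_sq_def inv_metric_def m_def inner_vec_def matrix_vector_mult_def
          sum_distrib_left mult_ac)
  qed (use pos n in auto)
  then show "?S h i j k = 0"
    by (simp add: S)
qed

end
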